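(* Let $n,k$ be natural numbers with $k\le\binom{n}{2}$, and write $k=\binom{d}{2}+e$ with integers $d\ge1$ and $0\le e<d$. Let $G$ be the graph on $n$ vertices obtained from the complete graph $K_d$ by adding one new vertex adjacent to exactly $e$ vertices of $K_d$, all remaining vertices being isolated. Then $G$ has $k$ edges and $\beta(G)=\beta_+(n,k)$.
   Context: All graphs are finite and simple. For a graph $H$, let $c_i(H)$ be the number of cliques of size $i$ in $H$ ($c_0(H)=1$) and $\omega(H)$ the clique number. The $PC$-polynomial is $PC(H,x)=\sum_{i=0}^{\omega(H)}(-1)^i c_i(H)x^{\omega(H)-i}$, and $\beta(H)$ denotes its largest real root (which exists, is positive, and has maximal modulus among all complex roots of $PC(H,x)$). $G(n,k)$ is the set of graphs with $n$ vertices and $k$ edges, and $\beta_+(n,k)=\max_{H\in G(n,k)}\beta(H)$. *)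

theory Defs
  imports Complex_Main "HOL-Library.Ramsey" "HOL-Computational_Algebra.Polynomial"
begin

text \<open>
  A graph is given by its vertex set \<open>V\<close> and its edge set \<open>E\<close>, the edges being two-element
  subsets of \<open>V\<close>; this makes it simple.
\<close>

definition graph :: "'a set \<Rightarrow> 'a set set \<Rightarrow> bool" where
  "graph V E \<longleftrightarrow> finite V \<and> E \<subseteq> [V]\<^bsup>2\<^esup>"

definition clique_count :: "'a set \<Rightarrow> 'a set set \<Rightarrow> nat \<Rightarrow> nat" where
  "clique_count V E i = card {K \<in> [V]\<^bsup>i\<^esup>. clique K E}"

definition clique_number :: "'a set \<Rightarrow> 'a set set \<Rightarrow> nat" where
  "clique_number V E = Max {card K |K. K \<subseteq> V \<and> clique K E}"

definition PC :: "'a set \<Rightarrow> 'a set set \<Rightarrow> real poly" where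
  "PC V E = (\<Sum>i\<le>clique_number V E.
     monom ((- 1) ^ i * real (clique_count V E i)) (clique_number V E - i))"

text \<open>
  \<^const>\<open>PC\<close> is monic, so its set of roots is finite. For a graph without vertices \<^const>\<open>PC\<close> is
  the constant \<open>1\<close>, and the following value is then meaningless.
\<close>

definition beta :: "'a set \<Rightarrow> 'a set set \<Rightarrow> real" where
  "beta V E = Max {x. poly (PC V E) x = 0}"

text \<open>
  Since \<^const>\<open>beta\<close> is invariant under isomorphism, graphs with \<open>n\<close> vertices are represented
  by the (finitely many) labelled graphs on \<open>{..<n}\<close>.
\<close>

definition edge_sets :: "nat \<Rightarrow> nat \<Rightarrow> nat set set set" where
  "edge_sets n k = {E. graph {..<n} E \<and> card E = k}"

definition beta_plus :: "nat \<Rightarrow> nat \<Rightarrow> real" where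
  "beta_plus n k = Max (beta {..<n} ` edge_sets n k)"

text \<open>
  A complete graph on a \<open>d\<close>-set \<open>D\<close>, a new vertex \<open>v\<close> adjacent to exactly the \<open>e\<close> vertices
  in \<open>S \<subseteq> D\<close>, and isolated vertices otherwise. The complete graph itself, where there is no room
  for a new vertex, is included for \<open>e = 0\<close>; then \<open>S\<close> is empty and \<open>v\<close> plays no role.
\<close>

definition clique_plus_vertex :: "nat \<Rightarrow> nat \<Rightarrow> 'a set \<Rightarrow> 'a set set \<Rightarrow> bool" where
  "clique_plus_vertex d e V E \<longleftrightarrow> finite V \<and>
     (\<exists>D S v. D \<subseteq> V \<and> card D = d \<and> S \<subseteq> D \<and> card S = e \<and>
       (v \<in> V - D \<or> V = D \<and> e = 0) \<and>
       E = [D]\<^bsup>2\<^esup> \<union> {{v, x} |x. x \<in> S})"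

lemma clique_plus_vertex_exists:
  assumes "n \<ge> 1" "(d choose 2) + e \<le> n choose 2" "d \<ge> 1" "e < d"
  shows "\<exists>E. clique_plus_vertex d e {..<n} E \<and> graph {..<n} E"
proof -
  have "d \<le> n"
  proof (rule ccontr)
    assume "\<not> d \<le> n"
    then have "Suc n choose 2 \<le> d choose 2" by (intro binomial_right_mono) auto
    moreover have "Suc n choose 2 = n + (n choose 2)" by (simp add: numeral_2_eq_2)
    ultimately show False using assms by simp
  qed
  have room: "d < n \<or> d = n \<and> e = 0"
    using \<open>d \<le> n\<close> assms(2) by (cases "d = n") auto
  let ?E = "[{..<d}]\<^bsup>2\<^esup> \<union> {{d, x} |x. x \<in> {..<e}}"
  have "clique_plus_vertex d e {..<n} ?E"
    unfolding clique_plus_vertex_def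
    using room assms by (intro conjI exI[of _ "{..<d}"] exI[of _ "{..<e}"] exI[of _ d]) auto
  moreover have "graph {..<n} ?E"
    unfolding graph_def using room assms by (auto simp: nsets_def)
  ultimately show ?thesis by blast
qed

end

theory Submission
  imports Defs
begin

text \<open>
  The reciprocal of \<open>\<beta>\<close> is the least positive root \<open>\<rho>\<close> of the clique polynomial
  \<open>f\<^sub>W(x) = \<Sum>\<^sub>K (-x)\<^bsup>|K|\<^esup>\<close>, where \<open>K\<close> ranges over the cliques in \<open>W\<close>, and
  \<open>f\<close> satisfies \<open>f\<^sub>W = f\<^bsub>W-v\<^esub> - x f\<^bsub>N(v)\<inter>W\<^esub>\<close>. On \<open>[0, \<rho>]\<close> the clique polynomials of all induced
  subgraphs are nonnegative, so \<open>f\<^sub>W\<close> decreases in \<open>W\<close> and \<open>f\<^sub>W \<le> (1-x)\<^bsup>|W|\<^esup>\<close>. Removing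
  vertices of minimum degree one after the other therefore gives
  \<open>f\<^sub>V \<ge> 1 - x \<Sum>\<^sub>i (1-x)\<^bsup>\<delta>\<^sub>i\<^esup>\<close>, where the degrees \<open>\<delta>\<^sub>i\<close> at removal add up to the number of
  edges. By convexity of \<open>t \<mapsto> (1-x)\<^bsup>t\<^esup>\<close> the right-hand side is smallest for the degrees
  \<open>0, 1, \<dots>, d-1, e, 0, \<dots>, 0\<close>, where it is the clique polynomial of \<open>K\<^sub>d\<close> plus a vertex. Hence the
  least positive root of the latter is at most \<open>\<rho>\<close>.
\<close>

section \<open>The clique polynomial\<close>

text \<open>This is the independence polynomial of the complement graph at \<open>-x\<close>. The
  edge set stays fixed while \<open>W\<close> varies, so that induced subgraphs and neighbourhoods
  share one \<open>E\<close>.\<close>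

definition clique_fun :: "'a set set \<Rightarrow> 'a set \<Rightarrow> real \<Rightarrow> real" where
  "clique_fun E W x = (\<Sum>K | K \<subseteq> W \<and> clique K E. (- x) ^ card K)"

lemma clique_empty [simp]: "clique {} E"
  by (simp add: clique_def)

lemma clique_subset: "clique K E \<Longrightarrow> L \<subseteq> K \<Longrightarrow> clique L E"
  by (auto simp: clique_def)

lemma clique_fun_empty [simp]: "clique_fun E {} x = 1"
proof -
  have "{K. K \<subseteq> {} \<and> clique K E} = {{}}" by auto
  then show ?thesis by (simp add: clique_fun_def)
qed

lemma clique_insert:
  assumes "v \<notin> K"
  shows "clique (insert v K) E \<longleftrightarrow> clique K E \<and> (\<forall>w\<in>K. {v, w} \<in> E)"
  using assms by (fastforce simp: clique_def insert_commute)

text \<open>A clique of the larger set either avoids \<open>v\<close> or is \<open>v\<close>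
  together with a clique among its neighbours; in the second case \<open>v\<close> contributes one
  more factor \<open>-x\<close>.\<close>

lemma clique_fun_insert:
  assumes "finite W" "v \<notin> W"
  shows "clique_fun E (insert v W) x = clique_fun E W x - x * clique_fun E {w \<in> W. {v, w} \<in> E} x"
proof -
  let ?N = "{w \<in> W. {v, w} \<in> E}"
  let ?A = "{K. K \<subseteq> W \<and> clique K E}" and ?B = "{K. K \<subseteq> ?N \<and> clique K E}"
  have fin: "finite ?A" "finite ?B" using assms by auto
  have split: "{K. K \<subseteq> insert v W \<and> clique K E} = ?A \<union> insert v ` ?B" (is "?C = _")
  proof (intro equalityI subsetI)
    fix K assume K: "K \<in> ?C"
    show "K \<in> ?A \<union> insert v ` ?B"
    proof (cases "v \<in> K")
      case True
      then obtain L where L: "K = insert v L" "v \<notin> L" by (metis Set.set_insert)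
      then have "L \<in> ?B" using K by (auto simp: clique_insert)
      then show ?thesis using L by blast
    qed (use K in blast)
  next
    fix K assume "K \<in> ?A \<union> insert v ` ?B"
    then show "K \<in> ?C"
    proof
      assume "K \<in> insert v ` ?B"
      then obtain L where L: "K = insert v L" "L \<subseteq> ?N" "clique L E" by blast
      then have "v \<notin> L" using assms by blast
      then show ?thesis using L by (auto simp: clique_insert)
    qed auto
  qed
  have inj: "inj_on (insert v) ?B" using assms(2) by (auto simp: inj_on_def)
  have "clique_fun E (insert v W) x
      = (\<Sum>K\<in>?A. (- x) ^ card K) + (\<Sum>K\<in>insert v ` ?B. (- x) ^ card K)"
    unfolding clique_fun_def split using fin assms(2) by (intro sum.union_disjoint) auto
  also have "(\<Sum>K\<in>insert v ` ?B. (- x) ^ card K) = (\<Sum>K\<in>?B. (- x) ^ card (insert v K))"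
    using inj by (simp add: sum.reindex)
  also have "\<dots> = (\<Sum>K\<in>?B. (- x) * (- x) ^ card K)"
  proof (rule sum.cong)
    fix K assume "K \<in> ?B"
    then have "finite K" "v \<notin> K" using assms by (auto intro: finite_subset)
    then show "(- x) ^ card (insert v K) = (- x) * (- x) ^ card K" by simp
  qed simp
  finally show ?thesis by (simp add: clique_fun_def sum_distrib_left sum_negf)
qed

lemma clique_fun_clique:
  assumes "finite W" "clique W E"
  shows "clique_fun E W x = (1 - x) ^ card W"
  using assms
proof (induction W rule: finite_induct)
  case (insert v W)
  then have "{w \<in> W. {v, w} \<in> E} = W" "clique W E" by (auto simp: clique_insert)
  then show ?case using insert by (simp add: clique_fun_insert algebra_simps)
qed simp

lemma clique_fun_0 [simp]:
  assumes "finite W"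
  shows "clique_fun E W 0 = 1"
  using assms by (induction W rule: finite_induct) (auto simp: clique_fun_insert)

section \<open>First positive zeros and induced subgraphs\<close>

lemma continuous_on_clique_fun: "continuous_on A (clique_fun E W)"
  unfolding clique_fun_def by (intro continuous_intros)

text \<open>By compactness there is a least \<open>r\<close> in \<open>[0, b]\<close> with
  \<open>f r \<le> 0\<close>. The intermediate value theorem gives a zero in \<open>[0, r]\<close>,
  which by minimality is \<open>r\<close> itself.\<close>

lemma first_zero:
  fixes f :: "real \<Rightarrow> real"
  assumes "continuous_on UNIV f" "f 0 > 0" "f b \<le> 0" "b \<ge> 0"
  obtains r where "0 < r" "r \<le> b" "f r = 0" "\<And>y. 0 \<le> y \<Longrightarrow> y < r \<Longrightarrow> f y > 0"
proof -
  let ?A = "{0..b} \<inter> {y. f y \<le> 0}"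
  have "closed {y. f y \<le> 0}"
    by (rule closed_Collect_le) (use assms in auto)
  then have "compact ?A" by (intro compact_Int_closed) auto
  moreover have "?A \<noteq> {}" using assms by auto
  ultimately obtain r where r: "r \<in> ?A" "\<And>y. y \<in> ?A \<Longrightarrow> r \<le> y"
    using compact_attains_inf by metis
  have pos: "f y > 0" if "0 \<le> y" "y < r" for y
    using r(2)[of y] r(1) that by (cases "f y \<le> 0") auto
  have "r > 0" using r(1) assms(2) by (cases "r = 0") auto
  moreover have "f r = 0"
  proof -
    obtain s where s: "0 \<le> s" "s \<le> r" "f s = 0"
      using IVT2'[of f r 0 0] r(1) assms(1,2) \<open>r > 0\<close> continuous_on_subset by fastforce
    then show ?thesis using pos[of s] by (cases "s = r") auto
  qed
  ultimately show ?thesis using that r pos by auto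
qed

lemma clique_fun_first_zero:
  assumes "finite V" "clique_fun E V b \<le> 0" "b \<ge> 0"
  obtains r where "0 < r" "r \<le> b" "clique_fun E V r = 0"
    "\<And>y. 0 \<le> y \<Longrightarrow> y < r \<Longrightarrow> clique_fun E V y > 0"
  by (rule first_zero[OF continuous_on_clique_fun, of E V b]) (use assms in simp_all)

text \<open>
  If the clique polynomial of \<open>V - {v}\<close> had a first root \<open>r < b\<close>, the recursion at \<open>r\<close> would give
  \<open>f\<^sub>V(r) \<le> 0\<close>.
\<close>

lemma clique_fun_pos_subset:
  assumes "finite V" "\<And>y. 0 \<le> y \<Longrightarrow> y < b \<Longrightarrow> clique_fun E V y > 0"
    and "W \<subseteq> V" "0 \<le> y" "y < b"
  shows "clique_fun E W y > 0"
  using assms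
proof (induction V arbitrary: b W y rule: finite_psubset_induct)
  case (psubset V)
  show ?case
  proof (cases "W = V")
    case True
    then show ?thesis using psubset.prems by simp
  next
    case False
    then obtain v where v: "v \<in> V" "v \<notin> W" using psubset.prems by blast
    let ?U = "V - {v}"
    let ?N = "{w \<in> ?U. {v, w} \<in> E}"
    have U: "?U \<subset> V" "W \<subseteq> ?U" "finite ?U" using v psubset by auto
    have V: "clique_fun E V z = clique_fun E ?U z - z * clique_fun E ?N z" for z
      using clique_fun_insert[of ?U v E z] U v by (simp add: insert_absorb)
    have "clique_fun E ?U z > 0" if z: "0 \<le> z" "z < b" for z
    proof (rule ccontr)
      assume "\<not> ?thesis"
      then have "clique_fun E ?U z \<le> 0" by simp
      then obtain r where r: "0 < r" "r \<le> z" "clique_fun E ?U r = 0"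
          "\<And>y. 0 \<le> y \<Longrightarrow> y < r \<Longrightarrow> clique_fun E ?U y > 0"
        using clique_fun_first_zero[OF U(3) _ z(1)] by metis
      \<comment> \<open>The induction hypothesis for \<open>?U\<close> with bound \<open>r\<close>
        makes the polynomial of \<open>?N\<close> positive before \<open>r\<close>. A negative value
        at \<open>r\<close> would need a zero before \<open>r\<close>.\<close>
      have "clique_fun E ?N r \<ge> 0"
      proof (rule ccontr)
        assume neg: "\<not> ?thesis"
        then have "clique_fun E ?N r \<le> 0" by simp
        moreover have "finite ?N" "0 \<le> r" using U r by simp_all
        ultimately obtain s where s: "0 < s" "s \<le> r" "clique_fun E ?N s = 0"
          using clique_fun_first_zero[of ?N E r] by blast
        show False
          using psubset.IH[OF U(1), of r ?N s] r s neg by (cases "s = r") auto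
      qed
      then have "clique_fun E V r \<le> 0" using r V by simp
      then show False using psubset.prems(1)[of r] r z by simp
    qed
    then show ?thesis using psubset.IH[OF U(1), of b W y] U(2) psubset.prems by blast
  qed
qed

text \<open>Extends the preceding lemma to the endpoint \<open>b\<close>, where strict positivity
  may fail. It is applied with \<open>b\<close> the first root of \<open>V\<close>.\<close>

corollary clique_fun_nonneg_subset:
  assumes "finite V" "\<And>y. 0 \<le> y \<Longrightarrow> y < b \<Longrightarrow> clique_fun E V y > 0"
    and "W \<subseteq> V" "0 < b"
  shows "clique_fun E W b \<ge> 0"
proof (rule ccontr)
  assume neg: "\<not> ?thesis"
  have "finite W" using assms finite_subset by blast
  moreover have "clique_fun E W b \<le> 0" "0 \<le> b" using neg assms by simp_all
  ultimately obtain s where s: "0 < s" "s \<le> b" "clique_fun E W s = 0"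
    using clique_fun_first_zero[of W E b] by blast
  show False
    using clique_fun_pos_subset[OF assms(1), of b E W s] assms s neg by (cases "s = b") auto
qed

text \<open>A single vertex has polynomial \<open>1 - x\<close>, which vanishes at 1; positivity for
  \<open>V\<close> on all of \<open>[0, 2)\<close> would make it positive there.\<close>

lemma clique_fun_first_root:
  assumes "finite V" "V \<noteq> {}"
  obtains r where "0 < r" "clique_fun E V r = 0"
    "\<And>y. 0 \<le> y \<Longrightarrow> y < r \<Longrightarrow> clique_fun E V y > 0"
proof -
  obtain v where v: "v \<in> V" using assms by blast
  have v1: "clique_fun E {v} 1 = 0"
    using clique_fun_insert[of "{}" v E 1] by simp
  have "\<exists>b\<ge>0. clique_fun E V b \<le> 0"
  proof (rule ccontr)
    assume "\<not> ?thesis"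
    \<comment> \<open>Positivity is inherited only strictly below the bound, hence a bound greater
      than 1.\<close>
    then have "clique_fun E {v} 1 > 0"
      using clique_fun_pos_subset[OF assms(1), of 2 E "{v}" 1] v by fastforce
    then show False using v1 by simp
  qed
  then obtain b where "b \<ge> 0" "clique_fun E V b \<le> 0" by blast
  then show ?thesis
    using clique_fun_first_zero[of V E b] assms(1) that by metis
qed

text \<open>Adding a vertex subtracts \<open>x\<close> times the value at its neighbourhood, which
  is nonnegative by assumption.\<close>

lemma clique_fun_antimono:
  assumes "finite V" "0 \<le> x" "\<And>U. U \<subseteq> V \<Longrightarrow> clique_fun E U x \<ge> 0" and "W \<subseteq> V"
  shows "clique_fun E V x \<le> clique_fun E W x"
  using assms
proof (induction V rule: finite_psubset_induct)
  case (psubset V)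
  show ?case
  proof (cases "W = V")
    case False
    then obtain v where v: "v \<in> V" "v \<notin> W" using psubset.prems by blast
    let ?U = "V - {v}"
    let ?N = "{w \<in> ?U. {v, w} \<in> E}"
    have "clique_fun E V x = clique_fun E ?U x - x * clique_fun E ?N x"
      using clique_fun_insert[of ?U v E x] psubset.hyps v by (simp add: insert_absorb)
    also have "\<dots> \<le> clique_fun E ?U x"
      using psubset.prems(2)[of ?N] \<open>0 \<le> x\<close> by (auto intro!: mult_nonneg_nonneg)
    also have "\<dots> \<le> clique_fun E W x"
      by (rule psubset.IH) (use psubset.prems v in auto)
    finally show ?thesis .
  qed simp
qed

text \<open>The neighbourhood has at least the value of the whole set, so by the recursion each
  added vertex contributes at most a factor \<open>1 - x\<close>. This factor is nonnegative, being
  the value at a single vertex.\<close>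

lemma clique_fun_le_power:
  assumes "finite V" "0 \<le> x" "\<And>W. W \<subseteq> V \<Longrightarrow> clique_fun E W x \<ge> 0"
  shows "clique_fun E V x \<le> (1 - x) ^ card V"
  using assms
proof (induction V rule: finite_induct)
  case (insert v V)
  let ?N = "{w \<in> V. {v, w} \<in> E}"
  have nonneg: "clique_fun E W x \<ge> 0" if "W \<subseteq> V" for W
    using insert.prems that by blast
  have "clique_fun E {v} x = 1 - x" using clique_fun_insert[of "{}" v E x] by simp
  then have x1: "1 - x \<ge> 0" using insert.prems(2)[of "{v}"] by simp
  have "clique_fun E V x \<le> clique_fun E ?N x"
    using insert.hyps insert.prems nonneg by (intro clique_fun_antimono) auto
  then have "x * clique_fun E V x \<le> x * clique_fun E ?N x"
    using insert.prems by (intro mult_left_mono)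
  then have "clique_fun E (insert v V) x \<le> (1 - x) * clique_fun E V x"
    using insert.hyps by (simp add: clique_fun_insert algebra_simps)
  also have "\<dots> \<le> (1 - x) * (1 - x) ^ card V"
    using insert.IH nonneg insert.prems x1 by (intro mult_left_mono) auto
  finally show ?case using insert.hyps by simp
qed simp

section \<open>Edge counts\<close>

lemma choose_two_Suc: "Suc n choose 2 = n + (n choose 2)"
  by (simp add: numeral_2_eq_2)

text \<open>Count upwards: when the remainder reaches \<open>d\<close>, it completes the next
  binomial coefficient and restarts at 0.\<close>

lemma choose_two_decomposition_exists: "\<exists>d e. k = (d choose 2) + e \<and> e < (d::nat)"
proof (induction k)
  case 0
  show ?case by (rule exI[of _ 1]) simp
next
  case (Suc k)
  then obtain d e where de: "k = (d choose 2) + e" "e < d" by blast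
  show ?case
  proof (cases "Suc e < d")
    case True
    then show ?thesis using de by (intro exI[of _ d] exI[of _ "Suc e"]) simp
  next
    case False
    then show ?thesis using de by (intro exI[of _ "Suc d"] exI[of _ 0]) (simp add: choose_two_Suc)
  qed
qed

lemma choose_two_decomposition_le:
  fixes a b c d :: nat
  assumes "(a choose 2) + b \<le> (c choose 2) + d" "d < c"
  shows "a \<le> c"
proof (rule ccontr)
  assume "\<not> a \<le> c"
  then have "Suc c choose 2 \<le> a choose 2" by (intro binomial_right_mono) auto
  then show False using assms by (simp add: choose_two_Suc)
qed

lemma choose_two_decomposition_unique:
  fixes a b c d :: nat
  assumes "(a choose 2) + b = (c choose 2) + d" "b < a" "d < c"
  shows "a = c \<and> b = d"
proof -
  have "a = c"
    using assms choose_two_decomposition_le[of a b c d] choose_two_decomposition_le[of c d a b] by simp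
  then show ?thesis using assms by simp
qed

section \<open>Induced edges and minimum degree\<close>

lemma nsets_2_insert:
  assumes "v \<notin> W"
  shows "[insert v W]\<^bsup>2\<^esup> = [W]\<^bsup>2\<^esup> \<union> (\<lambda>w. {v, w}) ` W"
  using assms by (auto simp: nsets_2_eq insert_commute)

lemma card_edges_insert:
  assumes "finite W" "v \<notin> W"
  shows "card (E \<inter> [insert v W]\<^bsup>2\<^esup>) = card (E \<inter> [W]\<^bsup>2\<^esup>) + card {w \<in> W. {v, w} \<in> E}"
proof -
  have "E \<inter> [insert v W]\<^bsup>2\<^esup> = (E \<inter> [W]\<^bsup>2\<^esup>) \<union> (\<lambda>w. {v, w}) ` {w \<in> W. {v, w} \<in> E}"
    using assms by (auto simp: nsets_2_insert)
  moreover have "(E \<inter> [W]\<^bsup>2\<^esup>) \<inter> (\<lambda>w. {v, w}) ` {w \<in> W. {v, w} \<in> E} = {}"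
    using assms by (auto simp: nsets_def)
  moreover have "inj_on (\<lambda>w. {v, w}) {w \<in> W. {v, w} \<in> E}"
    by (auto simp: inj_on_def doubleton_eq_iff)
  ultimately show ?thesis
    using assms by (simp add: card_Un_disjoint finite_imp_finite_nsets card_image)
qed

text \<open>Deleting a vertex lowers the other degrees by at most one, so successive deletions
  remove at least \<open>s\<close>, \<open>s - 1\<close>, ..., 1 edges.\<close>

lemma choose_two_min_degree_le:
  assumes "finite V" "V \<noteq> {}" "\<And>v. v \<in> V \<Longrightarrow> s \<le> card {w \<in> V - {v}. {v, w} \<in> E}"
  shows "Suc s choose 2 \<le> card (E \<inter> [V]\<^bsup>2\<^esup>)"
  using assms
proof (induction s arbitrary: V)
  case (Suc s)
  obtain v where v: "v \<in> V" using Suc.prems by blast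
  let ?U = "V - {v}"
  have deg: "card {w \<in> ?U. {v, w} \<in> E} \<ge> Suc s" using Suc.prems v by blast
  then have "card {w \<in> ?U. {v, w} \<in> E} \<noteq> 0" by linarith
  then have "{w \<in> ?U. {v, w} \<in> E} \<noteq> {}" by (metis card.empty)
  then have "?U \<noteq> {}" by blast
  have "s \<le> card {w \<in> ?U - {u}. {u, w} \<in> E}" if u: "u \<in> ?U" for u
  proof -
    have "{w \<in> V - {u}. {u, w} \<in> E} \<subseteq> insert v {w \<in> ?U - {u}. {u, w} \<in> E}" by auto
    then have "card {w \<in> V - {u}. {u, w} \<in> E} \<le> card (insert v {w \<in> ?U - {u}. {u, w} \<in> E})"
      using Suc.prems(1) by (intro card_mono) auto
    also have "\<dots> = Suc (card {w \<in> ?U - {u}. {u, w} \<in> E})"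
      using Suc.prems(1) by (subst card_insert_disjoint) auto
    finally have "card {w \<in> V - {u}. {u, w} \<in> E} \<le> Suc (card {w \<in> ?U - {u}. {u, w} \<in> E})" .
    moreover have "Suc s \<le> card {w \<in> V - {u}. {u, w} \<in> E}" using Suc.prems(3) u by blast
    ultimately show ?thesis by linarith
  qed
  then have "Suc s choose 2 \<le> card (E \<inter> [?U]\<^bsup>2\<^esup>)"
    using Suc.IH[of ?U] \<open>?U \<noteq> {}\<close> Suc.prems by blast
  moreover have "card (E \<inter> [V]\<^bsup>2\<^esup>) = card (E \<inter> [?U]\<^bsup>2\<^esup>) + card {w \<in> ?U. {v, w} \<in> E}"
    using card_edges_insert[of ?U v E] v Suc.prems(1) by (simp add: insert_absorb)
  ultimately show ?case using deg choose_two_Suc[of "Suc s"] by linarith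
qed (simp add: binomial_eq_0)

section \<open>The extremal bound\<close>

text \<open>Convexity of the exponential: for a fixed sum of exponents, the more spread pair has the
  larger sum of powers. The difference factors as
  \<open>q ^ d * ((1 - q ^ s) * (1 - q ^ t))\<close>.\<close>

lemma power_sum_le:
  fixes q :: real
  assumes "0 \<le> q" "q \<le> 1" "a + b = c + d" "d \<le> a" "d \<le> b"
  shows "q ^ a + q ^ b \<le> q ^ c + q ^ d"
proof -
  define s t where "s = a - d" and "t = b - d"
  have abc: "a = d + s" "b = d + t" "c = d + s + t" using assms by (auto simp: s_def t_def)
  have "0 \<le> q ^ d * ((1 - q ^ s) * (1 - q ^ t))"
    using assms by (intro mult_nonneg_nonneg) (auto simp: power_le_one)
  also have "\<dots> = q ^ c + q ^ d - (q ^ a + q ^ b)"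
    by (simp add: abc power_add algebra_simps)
  finally show ?thesis by simp
qed

text \<open>The right-hand side is the polynomial of the clique plus a vertex. The last factor is a
  real difference because \<open>card V = d\<close> can occur; then \<open>e = 0\<close> and the
  last two terms cancel. The induction deletes a vertex of minimum degree \<open>s\<close> and
  redistributes the pair of exponents formed by \<open>s\<close> and the old remainder.\<close>

lemma clique_fun_ge:
  assumes "finite V" "0 \<le> x" "\<And>W. W \<subseteq> V \<Longrightarrow> clique_fun E W x \<ge> 0" "V \<noteq> {}"
    and "card (E \<inter> [V]\<^bsup>2\<^esup>) = (d choose 2) + e" "e < d"
  shows "clique_fun E V x \<ge> (1 - x) ^ d - x * (1 - x) ^ e - x * (real (card V) - real d - 1)"
  using assms
proof (induction V arbitrary: d e rule: finite_psubset_induct)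
  case (psubset V)
  define deg where "deg v = card {w \<in> V - {v}. {v, w} \<in> E}" for v
  obtain v where v: "v \<in> V" "\<And>u. u \<in> V \<Longrightarrow> deg v \<le> deg u"
    using psubset.hyps psubset.prems(3) arg_min_if_finite[of V deg]
    by (metis linorder_not_less)
  define q where "q = 1 - x"
  define s where "s = deg v"
  let ?U = "V - {v}" 
  let ?N = "{w \<in> ?U. {v, w} \<in> E}"
  have V: "clique_fun E V x = clique_fun E ?U x - x * clique_fun E ?N x"
    using clique_fun_insert[of ?U v E x] psubset.hyps v by (simp add: insert_absorb)
  have v1: "clique_fun E {v} x = q"
    using clique_fun_insert[of "{}" v E x] by (simp add: q_def)
  then have x1: "q \<ge> 0" using psubset.prems(2)[of "{v}"] v by simp
  have q1: "q \<le> 1" using psubset.prems(1) by (simp add: q_def)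
  have nonneg: "clique_fun E W x \<ge> 0" if "W \<subseteq> ?U" for W
    using psubset.prems that by blast
  have "clique_fun E ?N x \<le> q ^ s"
    unfolding s_def deg_def q_def
  proof (rule clique_fun_le_power)
    show "clique_fun E W x \<ge> 0" if "W \<subseteq> ?N" for W
      by (rule nonneg) (use that in blast)
  qed (use psubset.hyps psubset.prems(1) in auto)
  then have "x * clique_fun E ?N x \<le> x * q ^ s"
    using psubset.prems(1) by (rule mult_left_mono)
  then have VU: "clique_fun E V x \<ge> clique_fun E ?U x - x * q ^ s" using V by simp
  have edges: "(d choose 2) + e = card (E \<inter> [?U]\<^bsup>2\<^esup>) + s"
    using card_edges_insert[of ?U v E] v psubset.hyps psubset.prems(4) by (simp add: insert_absorb s_def deg_def)
  \<comment> \<open>Minimality of the degree is used here: it leads to \<open>s \<le> c\<close>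
    below, so adding \<open>s\<close> edges to \<open>(c choose 2) + f\<close> raises the clique
    size by at most one.\<close>
  have "Suc s choose 2 \<le> card (E \<inter> [V]\<^bsup>2\<^esup>)"
    by (rule choose_two_min_degree_le) (use psubset.hyps v in \<open>auto simp: s_def deg_def\<close>)
  then have small: "s choose 2 \<le> card (E \<inter> [?U]\<^bsup>2\<^esup>)"
    using edges psubset.prems(4) by (simp add: choose_two_Suc)
  have cV: "real (card V) = real (card ?U) + 1"
    using card.remove[OF psubset.hyps v(1)] by simp
  show ?case
  proof (cases "?U = {}")
    case True
    then have "V = {v}" using v by blast
    then have "s = 0" unfolding s_def deg_def by simp
    moreover have "E \<inter> [?U]\<^bsup>2\<^esup> = {}" unfolding True by (auto simp: nsets_def)
    ultimately have "(d choose 2) + e = (1 choose 2) + 0"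
      using edges by (simp add: binomial_eq_0)
    then have "d = 1" "e = 0" using choose_two_decomposition_unique[of d e 1 0] psubset.prems(5) by auto
    then show ?thesis using \<open>V = {v}\<close> v1 by (simp add: q_def)
  next
    case False
    obtain c f where cf: "card (E \<inter> [?U]\<^bsup>2\<^esup>) = (c choose 2) + f" "f < c"
      using choose_two_decomposition_exists by blast
    have "s \<le> c" using small cf choose_two_decomposition_le[of s 0 c f] by simp
    have "?U \<subset> V" using v by blast
    then have IH: "clique_fun E ?U x \<ge> q ^ c - x * q ^ f - x * (real (card ?U) - real c - 1)"
      unfolding q_def by (rule psubset.IH[OF _ psubset.prems(1) nonneg False cf])
    have "q ^ c - x * q ^ f - x * (real (card ?U) - real c - 1) - x * q ^ s
      \<ge> q ^ d - x * q ^ e - x * (real (card V) - real d - 1)"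
    proof (cases "f + s < c")
      case True
      \<comment> \<open>The clique size is unchanged. The exponents \<open>f\<close>,
        \<open>s\<close> are replaced by \<open>f + s\<close>, 0, and the exponent 0 accounts for
        one more isolated vertex.\<close>
      then have "d = c \<and> e = f + s"
        using edges cf psubset.prems(5) choose_two_decomposition_unique[of d e c "f + s"] by simp
      moreover have "x * (q ^ f + q ^ s) \<le> x * (q ^ (f + s) + q ^ 0)"
        using x1 q1 psubset.prems(1) by (intro mult_left_mono power_sum_le) auto
      ultimately show ?thesis using cV by (simp add: algebra_simps)
    next
      case False
      \<comment> \<open>The clique grows by one. The exponents \<open>f\<close>, \<open>s\<close>
        are replaced by \<open>c\<close>, \<open>e\<close>, where \<open>e\<close> is at most both
        \<open>f\<close> and \<open>s\<close>; the power with exponent \<open>c\<close> is absorbed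
        into \<open>q ^ Suc c\<close>.\<close>
      then have *: "d = Suc c \<and> e = f + s - c"
        using edges cf \<open>s \<le> c\<close> psubset.prems(5)
          choose_two_decomposition_unique[of d e "Suc c" "f + s - c"] by (simp add: choose_two_Suc)
      moreover have "x * (q ^ f + q ^ s) \<le> x * (q ^ c + q ^ e)"
        using x1 q1 psubset.prems(1) False * \<open>s \<le> c\<close> cf by (intro mult_left_mono power_sum_le) auto
      moreover have "q ^ Suc c = q ^ c - x * q ^ c" by (simp add: q_def algebra_simps)
      ultimately show ?thesis using cV by (simp add: algebra_simps del: power_Suc)
    qed
    then show ?thesis using IH VU unfolding q_def by linarith
  qed
qed

section \<open>The clique plus a vertex attains the bound\<close>

lemma clique_fun_add_isolated:
  assumes "finite U" "finite W" "U \<inter> W = {}" "\<And>u w. u \<in> U \<Longrightarrow> w \<in> U \<union> W \<Longrightarrow> {u, w} \<notin> E"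
  shows "clique_fun E (U \<union> W) x = clique_fun E W x - x * real (card U)"
  using assms
proof (induction U rule: finite_induct)
  case (insert u U)
  then have "clique_fun E (U \<union> W) x = clique_fun E W x - x * real (card U)" by auto
  moreover have N: "{w \<in> U \<union> W. {u, w} \<in> E} = {}" using insert.prems by auto
  moreover have "u \<notin> U \<union> W" "finite (U \<union> W)" using insert by auto
  then have "clique_fun E (insert u (U \<union> W)) x = clique_fun E (U \<union> W) x - x"
    using clique_fun_insert[of "U \<union> W" u E x] unfolding N by simp
  ultimately show ?case using insert.hyps by (simp add: algebra_simps)
qed simp

lemma clique_fun_clique_plus_vertex:
  assumes "clique_plus_vertex d e V E"
  shows "clique_fun E V x = (1 - x) ^ d - x * (1 - x) ^ e - x * (real (card V) - real d - 1)"
proof -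
  obtain D S v where D: "D \<subseteq> V" "card D = d" "S \<subseteq> D" "card S = e"
      "v \<in> V - D \<or> V = D \<and> e = 0" "E = [D]\<^bsup>2\<^esup> \<union> {{v, x} |x. x \<in> S}" and fin: "finite V"
    using assms unfolding clique_plus_vertex_def by blast
  have finD: "finite D" "finite S" using D fin by (auto intro: finite_subset)
  have "clique D E" using D by (auto simp: clique_def nsets_2_eq)
  then have cD: "clique_fun E D x = (1 - x) ^ d" "clique_fun E S x = (1 - x) ^ e"
    using D finD by (auto simp: clique_fun_clique clique_subset)
  show ?thesis
  proof (cases "v \<in> V - D")
    case True
    let ?R = "V - insert v D"
    have "{w \<in> D. {v, w} \<in> E} = S"
      using True D by (auto simp: nsets_2_eq doubleton_eq_iff)
    then have 1: "clique_fun E (insert v D) x = (1 - x) ^ d - x * (1 - x) ^ e"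
      using clique_fun_insert[of D v E x] finD cD True by simp
    have "V = ?R \<union> insert v D" using D True by blast
    moreover have "clique_fun E (?R \<union> insert v D) x
        = clique_fun E (insert v D) x - x * real (card ?R)"
      using fin finD D by (intro clique_fun_add_isolated) (auto simp: nsets_2_eq doubleton_eq_iff)
    moreover have "real (card V) = real (card ?R) + real d + 1"
    proof -
      have "card V = card ?R + card (insert v D)"
        using fin finD calculation(1) by (metis Diff_disjoint card_Un_disjoint finite_Diff finite_insert inf_commute)
      then show ?thesis using True finD D by simp
    qed
    ultimately show ?thesis using 1 by simp
  next
    case False
    \<comment> \<open>With no vertex outside the clique, the terms \<open>x * (1 - x) ^ 0\<close>
      and \<open>x * (d - d - 1)\<close> cancel.\<close>
    then have "V = D" "e = 0" using D by auto
    then show ?thesis using cD D by simp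
  qed
qed

lemma card_edges_clique_plus_vertex:
  assumes "clique_plus_vertex d e V E"
  shows "card E = (d choose 2) + e"
proof -
  obtain D S v where D: "D \<subseteq> V" "card D = d" "S \<subseteq> D" "card S = e"
      "v \<in> V - D \<or> V = D \<and> e = 0" "E = [D]\<^bsup>2\<^esup> \<union> {{v, x} |x. x \<in> S}" and fin: "finite V"
    using assms unfolding clique_plus_vertex_def by blast
  have finD: "finite D" "finite S" using D fin by (auto intro: finite_subset)
  have S: "{{v, x} |x. x \<in> S} = (\<lambda>x. {v, x}) ` S" by auto
  \<comment> \<open>The definition allows \<open>v\<close> in \<open>D\<close> only when
    \<open>e = 0\<close>.\<close>
  have "v \<notin> D \<or> S = {}" using D finD by auto
  then have "[D]\<^bsup>2\<^esup> \<inter> (\<lambda>x. {v, x}) ` S = {}" by (auto simp: nsets_def)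
  moreover have "card ((\<lambda>x. {v, x}) ` S) = e"
    using D by (subst card_image) (auto simp: inj_on_def doubleton_eq_iff)
  ultimately show ?thesis
    using D finD unfolding D(6) S
    by (subst card_Un_disjoint) (auto simp: finite_imp_finite_nsets card_nsets)
qed

section \<open>The largest root of the PC-polynomial\<close>

text \<open>The two polynomials are reciprocal to each other: group the cliques by size, which never
  exceeds the clique number.\<close>

lemma poly_PC:
  assumes "finite V" "x \<noteq> 0"
  shows "poly (PC V E) x = x ^ clique_number V E * clique_fun E V (1 / x)"
proof -
  let ?w = "clique_number V E"
  let ?C = "{K. K \<subseteq> V \<and> clique K E}"
  have fin: "finite ?C" using assms by simp
  have le: "card K \<le> ?w" if "K \<in> ?C" for K
    unfolding clique_number_def using that fin
    by (intro Max_ge) (auto simp: setcompr_eq_image)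
  have count: "clique_count V E i = card {K \<in> ?C. card K = i}" for i
  proof -
    have "{K \<in> [V]\<^bsup>i\<^esup>. clique K E} = {K \<in> ?C. card K = i}"
      using assms by (auto simp: nsets_def intro: finite_subset)
    then show ?thesis by (simp add: clique_count_def)
  qed
  have "x ^ ?w * clique_fun E V (1 / x) = (\<Sum>K\<in>?C. x ^ ?w * (- (1 / x)) ^ card K)"
    by (simp add: clique_fun_def sum_distrib_left)
  also have "\<dots> = (\<Sum>i\<le>?w. \<Sum>K | K \<in> ?C \<and> card K = i. x ^ ?w * (- (1 / x)) ^ card K)"
    using fin le by (intro sum.group[symmetric]) auto
  also have "\<dots> = (\<Sum>i\<le>?w. (- 1) ^ i * real (clique_count V E i) * x ^ (?w - i))"
  proof (rule sum.cong)
    fix i assume "i \<in> {..?w}"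
    then have "x ^ ?w * (- (1 / x)) ^ i = (- 1) ^ i * x ^ (?w - i)"
      using assms(2) by (simp add: power_diff power_minus[of "1 / x"] power_one_over field_simps)
    then show "(\<Sum>K | K \<in> ?C \<and> card K = i. x ^ ?w * (- (1 / x)) ^ card K)
        = (- 1) ^ i * real (clique_count V E i) * x ^ (?w - i)"
      by (simp add: count)
  qed simp
  finally show ?thesis by (simp add: PC_def poly_sum poly_monom)
qed

text \<open>Up to sign the constant term counts the maximum cliques. Thus 0 is not a root and
  inversion loses none; also \<open>PC\<close> is not the zero polynomial, so its roots are finite
  in number.\<close>

lemma poly_PC_0:
  assumes "finite V"
  shows "poly (PC V E) 0 \<noteq> 0"
proof -
  let ?w = "clique_number V E"
  have fin: "finite {card K |K. K \<subseteq> V \<and> clique K E}"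
    using assms by (simp add: setcompr_eq_image)
  have "?w \<in> {card K |K. K \<subseteq> V \<and> clique K E}"
    unfolding clique_number_def using clique_empty by (intro Max_in fin) blast
  then obtain K where "K \<subseteq> V" "clique K E" "card K = ?w" by auto
  then have "K \<in> {K \<in> [V]\<^bsup>?w\<^esup>. clique K E}"
    using assms by (auto simp: nsets_def intro: finite_subset)
  then have "clique_count V E ?w \<noteq> 0"
    unfolding clique_count_def using assms by (subst card_0_eq) (auto simp: finite_imp_finite_nsets)
  moreover have "poly (PC V E) 0 = (\<Sum>i\<le>?w. if i = ?w then (- 1) ^ i * real (clique_count V E i) else 0)"
    unfolding PC_def poly_sum by (intro sum.cong) (auto simp: poly_monom power_0_left)
  ultimately show ?thesis by simp
qed

lemma PC_roots:
  assumes "finite V"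
  shows "{x. poly (PC V E) x = 0} = {x. x \<noteq> 0 \<and> clique_fun E V (1 / x) = 0}"
proof (rule Collect_cong)
  fix x
  show "poly (PC V E) x = 0 \<longleftrightarrow> x \<noteq> 0 \<and> clique_fun E V (1 / x) = 0"
    using assms by (cases "x = 0") (simp_all add: poly_PC poly_PC_0)
qed

lemma finite_PC_roots:
  assumes "finite V"
  shows "finite {x. poly (PC V E) x = 0}"
  using poly_PC_0[OF assms, of E] by (intro poly_roots_finite) auto

lemma beta_ge:
  assumes "finite V" "0 < r" "clique_fun E V r = 0"
  shows "1 / r \<le> beta V E"
  unfolding beta_def using finite_PC_roots[OF assms(1)] PC_roots[OF assms(1)] assms
  by (intro Max_ge) auto

text \<open>The reciprocal of a root above \<open>1 / r\<close> would lie in \<open>[0, r)\<close>,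
  where the clique polynomial is positive.\<close>

lemma beta_first_root:
  assumes "finite V" "0 < r" "clique_fun E V r = 0" "\<And>y. 0 \<le> y \<Longrightarrow> y < r \<Longrightarrow> clique_fun E V y > 0"
  shows "beta V E = 1 / r"
  unfolding beta_def
proof (rule Max_eqI)
  show "1 / r \<in> {x. poly (PC V E) x = 0}" using PC_roots[OF assms(1)] assms by simp
  fix x assume "x \<in> {x. poly (PC V E) x = 0}"
  then have x: "x \<noteq> 0" "clique_fun E V (1 / x) = 0" using PC_roots[OF assms(1)] by blast+
  show "x \<le> 1 / r"
  proof (rule ccontr)
    assume "\<not> x \<le> 1 / r"
    then have "1 / r < x" by simp
    moreover from this have "0 < x" using assms(2) by (auto intro: less_trans[of 0 "1 / r"])
    ultimately have "0 \<le> 1 / x" "1 / x < r" using assms(2) by (simp_all add: field_simps)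
    then show False using assms(4)[of "1 / x"] x by simp
  qed
qed (rule finite_PC_roots[OF assms(1)])

text \<open>At the first root \<open>r\<close> of \<open>V\<close>, the lower bound is the value for
  \<open>U\<close>, hence at most 0; so \<open>U\<close> has a root in \<open>(0, r]\<close>. The
  two vertex types may differ, which allows comparison with graphs on \<open>{..<n}\<close>.\<close>

lemma beta_le_clique_plus_vertex:
  fixes V :: "'a set" and U :: "'b set"
  assumes "finite V" "V \<noteq> {}" "card (E \<inter> [V]\<^bsup>2\<^esup>) = (d choose 2) + e" "e < d"
    and "clique_plus_vertex d e U F" "card U = card V"
  shows "beta V E \<le> beta U F"
proof -
  obtain r where r: "0 < r" "clique_fun E V r = 0"
      "\<And>y. 0 \<le> y \<Longrightarrow> y < r \<Longrightarrow> clique_fun E V y > 0"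
    using clique_fun_first_root assms by metis
  have fin: "finite U" using assms(5) by (simp add: clique_plus_vertex_def)
  have "clique_fun F U r \<le> clique_fun E V r"
    using clique_fun_ge[of V r E d e] clique_fun_nonneg_subset[of V r E] assms r
    by (simp add: clique_fun_clique_plus_vertex)
  then have "clique_fun F U r \<le> 0" "0 \<le> r" using r by auto
  then obtain t where t: "0 < t" "t \<le> r" "clique_fun F U t = 0"
    using clique_fun_first_zero[OF fin] by metis
  have "beta V E = 1 / r" using beta_first_root assms r by blast
  also have "\<dots> \<le> 1 / t" using t by (simp add: frac_le)
  also have "\<dots> \<le> beta U F" using beta_ge fin t by blast
  finally show ?thesis .
qed

theorem theorem8p1:
  fixes n k d e :: nat
    and V :: "'a set" and E :: "'a set set"
  assumes "k \<le> n choose 2"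
    and "k = (d choose 2) + e"
    and "d \<ge> 1"
    and "e < d"
    and "graph V E"
    and "card V = n"
    and "clique_plus_vertex d e V E"
  shows "card E = k \<and> beta V E = beta_plus n k"
proof
  show k: "card E = k"
    using card_edges_clique_plus_vertex[OF assms(7)] assms(2) by simp
  \<comment> \<open>As \<open>d \<ge> 1\<close>, the clique supplies a vertex; on the empty vertex
    set \<open>beta\<close> would be meaningless.\<close>
  have V: "finite V" "V \<noteq> {}"
    using assms by (auto simp: graph_def clique_plus_vertex_def)
  then have "n \<ge> 1" using assms(6) by (metis One_nat_def Suc_leI card_gt_0_iff)
  then obtain L where L: "clique_plus_vertex d e {..<n} L" "graph {..<n} L"
    using clique_plus_vertex_exists assms by metis
  have inter: "F \<inter> [U]\<^bsup>2\<^esup> = F" if "graph U F" for U :: "'b set" and F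
    using that by (auto simp: graph_def)
  have "card L = k" using card_edges_clique_plus_vertex[OF L(1)] assms(2) by simp
  \<comment> \<open>Both graphs are extremal, so the comparison lemma applies in both directions and
    gives equality without constructing an isomorphism.\<close>
  have "beta V E \<le> beta {..<n} L"
    using V assms L k inter[OF assms(5)] by (intro beta_le_clique_plus_vertex[of _ _ d e]) auto
  moreover have "beta {..<n} L \<le> beta V E"
    using V assms L \<open>card L = k\<close> \<open>n \<ge> 1\<close> inter[OF L(2)]
    by (intro beta_le_clique_plus_vertex[of _ _ d e]) (auto simp: lessThan_empty_iff)
  moreover have "beta_plus n k = beta {..<n} L"
    unfolding beta_plus_def
  proof (rule Max_eqI)
    have "edge_sets n k \<subseteq> Pow ([{..<n}]\<^bsup>2\<^esup>)" by (auto simp: edge_sets_def graph_def)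
    then have "finite (edge_sets n k)"
      by (rule finite_subset) (simp add: finite_imp_finite_nsets)
    then show "finite (beta {..<n} ` edge_sets n k)" by simp
    show "beta {..<n} L \<in> beta {..<n} ` edge_sets n k"
      using L \<open>card L = k\<close> by (auto simp: edge_sets_def)
    fix y assume "y \<in> beta {..<n} ` edge_sets n k"
    then obtain F where F: "graph {..<n} F" "card F = k" "y = beta {..<n} F"
      by (auto simp: edge_sets_def)
    show "y \<le> beta {..<n} L"
      unfolding F(3) using assms L F \<open>n \<ge> 1\<close> inter[OF F(1)]
      by (intro beta_le_clique_plus_vertex[of _ _ d e]) (auto simp: lessThan_empty_iff)
  qed
  ultimately show "beta V E = beta_plus n k" by simp
qed

end
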